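(* There exists a family of $n$-node, $m$-edge directed graphs $G$ with polynomially-bounded positive integer edge weights such that, for a sufficiently small constant $\varepsilon>0$, any exact distance-preserving DAG cover of $G$ with $m^{1+\varepsilon}$ additional edges requires $\Omega(n^{1/6})$ DAGs.
   Context: A DAG cover of a weighted directed graph $G$ with $f$ additional edges and $g$ DAGs is a collection $D_1,\dots,D_g$ of weighted directed acyclic graphs, each with vertex set $V(G)$, such that $\left|\left(\bigcup_i E(D_i)\right)\setminus E(G)\right|\le f$. It is exact distance-preserving if for all $s,t\in V(G)$, $\mathrm{dist}_G(s,t)= \min_{i\in[g]}\mathrm{dist}_{D_i}(s,t)$ (distances are $\infty$ when no path exists), with $\mathrm{dist}_G(s,t)\le\mathrm{dist}_{D_i}(s,t)$ for each $i$. *)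

theory Defs
  imports Complex_Main "Graph_Theory.Graph_Theory"
begin

text \<open>
  Distances are the library's \<open>wf_digraph.\<mu>\<close>: the infimum, in the extended reals, of the
  costs of all walks, which is infinite when there is no walk.
\<close>

abbreviation weighted_dist ::
  "'a pair_pre_digraph \<Rightarrow> ('a \<times> 'a) weight_fun \<Rightarrow> 'a \<Rightarrow> 'a \<Rightarrow> ereal"
where
  "weighted_dist G w s t \<equiv> wf_digraph.\<mu> (with_proj G) w s t"

text \<open>
  The additional edges are counted as ordered pairs of vertices. Hence the \<open>D i\<close> may use edges of
  \<open>G\<close> free of charge, and an additional edge occurring in several \<open>D i\<close> counts once, whatever
  weights it carries there.
\<close>

definition dag_cover ::
  "'a pair_pre_digraph \<Rightarrow> real \<Rightarrow> nat \<Rightarrow> (nat \<Rightarrow> 'a pair_pre_digraph) \<Rightarrow> bool"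
where
  "dag_cover G f g D \<longleftrightarrow>
     (\<forall>i<g. pair_digraph (D i) \<and> acyclic (parcs (D i)) \<and> pverts (D i) = pverts G) \<and>
     real (card ((\<Union>i<g. parcs (D i)) - parcs G)) \<le> f"

text \<open>
  The weights \<open>wD i\<close> of the DAGs are arbitrary reals, not tied to \<open>w\<close> even on the edges of \<open>G\<close>;
  the lower bound on the distances keeps them from undercutting the distances of \<open>G\<close>. The infimum
  is the minimum over the \<open>g\<close> indices, and is infinite for \<open>g = 0\<close>.
\<close>

definition exact_distance_preserving ::
  "'a pair_pre_digraph \<Rightarrow> ('a \<times> 'a) weight_fun \<Rightarrow> nat \<Rightarrow> (nat \<Rightarrow> 'a pair_pre_digraph) \<Rightarrow>
   (nat \<Rightarrow> ('a \<times> 'a) weight_fun) \<Rightarrow> bool"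
where
  "exact_distance_preserving G w g D wD \<longleftrightarrow>
     (\<forall>s\<in>pverts G. \<forall>t\<in>pverts G.
        weighted_dist G w s t = (INF i\<in>{..<g}. weighted_dist (D i) (wD i) s t) \<and>
        (\<forall>i<g. weighted_dist G w s t \<le> weighted_dist (D i) (wD i) s t))"

end

theory Submission
  imports Defs
begin

text \<open>
  The vertices lie in \<open>L = 2 l\<close> cyclically ordered layers, with two coordinates inside each layer.
  Even steps move the first coordinate, odd ones the second; a step with label \<open>a < r\<close> moves by
  \<open>a\<close>, except that the last step of either kind moves by \<open>-(l - 1) a\<close>, so that a walk with constant
  labels \<open>a\<close> and \<open>b\<close> closes up after \<open>L\<close> steps. Regular steps cost \<open>a\<^sup>2\<close> and the last ones
  \<open>-(l - 1) a\<^sup>2\<close>, up to constants. On a closed walk of \<open>L\<close> steps the label of the last step is the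
  mean of the others, so convexity of the square makes these constant-label cycles exactly the
  cheapest closed walks. Hence an arc of such a cycle missing two edges is a unique shortest path.

  Two vertices of a cycle that are not adjacent on it determine the cycle. So if there are more
  cycles than additional edges, some cycle \<open>C\<close> has no additional edge between two of its vertices, and
  a DAG realising the distance along an arc of \<open>C\<close> must contain that arc. The \<open>l\<close> arcs that start at
  even layers miss pairwise disjoint pairs of edges, so two of them together form \<open>C\<close>, and
  each needs its own DAG. With \<open>l = k\<^sup>2\<close> and \<open>r = k\<^sup>3\<close> there are \<open>8 k^12\<close> vertices, at most \<open>8 k^15\<close>
  edges and \<open>k^16\<close> cycles.
\<close>

section \<open>Finite sums: rotation, parity and deviation from the mean\<close>

lemma sum_rotate:
  fixes f :: "nat \<Rightarrow> 'a::comm_monoid_add"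
  assumes "0 < n"
  shows "(\<Sum>k<n. f ((j + k) mod n)) = sum f {..<n}"
proof -
  have sub: "{..<n} \<subseteq> (\<lambda>k. (j + k) mod n) ` {..<n}"
  proof
    fix k assume "k \<in> {..<n}"
    have "(j + (n - j mod n + k) mod n) mod n = (j mod n + (n - j mod n + k)) mod n"
      by (simp add: mod_simps)
    also have "j mod n + (n - j mod n + k) = n + k"
      using mod_le_divisor[OF assms, of j] by linarith
    finally have "k = (j + (n - j mod n + k) mod n) mod n"
      using \<open>k \<in> _\<close> by simp
    then show "k \<in> (\<lambda>k. (j + k) mod n) ` {..<n}" using assms by force
  qed
  have "inj_on (\<lambda>k. (j + k) mod n) {..<n}"
    using sub by (intro finite_surj_inj) auto
  moreover have "(\<lambda>k. (j + k) mod n) ` {..<n} = {..<n}"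
    using sub assms by auto
  ultimately show ?thesis
    using sum.reindex[of "\<lambda>k. (j + k) mod n" "{..<n}" f] by simp
qed

lemma sum_lessThan_double:
  fixes f :: "nat \<Rightarrow> 'a::comm_monoid_add"
  shows "sum f {..<2 * n} = (\<Sum>i<n. f (2 * i)) + (\<Sum>i<n. f (2 * i + 1))"
  by (induction n) (simp_all add: algebra_simps)

text \<open>The variance identity. On a closed walk, \<open>f\<close> lists the labels of the
  regular steps of one kind and \<open>m\<close> is the label of the last such step; the left side
  is then the cost up to a constant, and the right side shows when it is least.\<close>

lemma sum_square_about_mean:
  fixes f :: "nat \<Rightarrow> int"
  assumes "sum f {..<n} = int n * m"
  shows "(\<Sum>i<n. (f i)\<^sup>2) - int n * m\<^sup>2 = (\<Sum>i<n. (f i - m)\<^sup>2)"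
proof -
  have "(\<Sum>i<n. (f i - m)\<^sup>2) = (\<Sum>i<n. (f i)\<^sup>2) - 2 * m * sum f {..<n} + int n * m\<^sup>2"
    by (simp add: power2_diff sum.distrib sum_subtractf sum_distrib_left mult_ac)
  also have "\<dots> = (\<Sum>i<n. (f i)\<^sup>2) - int n * m\<^sup>2"
    by (simp add: assms power2_eq_square algebra_simps)
  finally show ?thesis by simp
qed

subsection \<open>Walks and distances\<close>

text \<open>Without negative closed walks a path attains the infimum. This serves both
  \<open>graph n\<close>, whose weights are nonnegative, and the DAGs, whose weights may be negative
  but whose closed walks are empty.\<close>

lemma (in pair_digraph) dist_attained:
  assumes nonneg: "\<And>x p. awalk x p x \<Longrightarrow> 0 \<le> awalk_cost w p"
    and le: "\<mu> w u v \<le> ereal c"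
  obtains p where "awalk u p v" "awalk_cost w p \<le> c"
proof -
  have "\<mu> w u v < \<infinity>" using le by (auto intro: le_less_trans)
  note reach = iffD1[OF \<mu>_reach_conv this]
  obtain p where "apath u p v" "\<mu> w u v = ereal (awalk_cost w p)"
    using no_neg_cyc_reach_imp_path[OF reach, of w] nonneg by (metis not_less)
  with le that show thesis by (auto simp: apath_def)
qed

lemma (in pair_digraph) acyclic_closed_awalk:
  assumes "acyclic (parcs G)" "awalk x p x" shows "p = []"
  using assms reachable1_awalk[of x x] by (auto simp: acyclic_def)

text \<open>An empty arc list does not know its start, hence the argument \<open>u\<close>.\<close>

definition walk_vertex :: "'a \<Rightarrow> ('a \<times> 'a) list \<Rightarrow> nat \<Rightarrow> 'a" where
  "walk_vertex u p k = (if k = 0 then u else snd (p ! (k - 1)))"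

lemma walk_vertex_0 [simp]: "walk_vertex u p 0 = u"
  by (simp add: walk_vertex_def)

lemma walk_vertex_Cons_Suc [simp]: "walk_vertex u (e # p) (Suc k) = walk_vertex (snd e) p k"
  by (cases k) (simp_all add: walk_vertex_def)

lemma pcas_nth:
  assumes "pcas u p v" "k < length p"
  shows "p ! k = (walk_vertex u p k, walk_vertex u p (Suc k))"
  using assms
proof (induction p arbitrary: u k)
  case (Cons e p)
  then show ?case by (cases k) (auto simp: prod_eq_iff)
qed simp

lemma walk_vertex_length: "pcas u p v \<Longrightarrow> walk_vertex u p (length p) = v"
  by (induction p arbitrary: u) auto

lemma walk_vertex_append:
  assumes "pcas u p v"
  shows "k \<le> length p \<Longrightarrow> walk_vertex u (p @ p') k = walk_vertex u p k"
    and "walk_vertex u (p @ p') (length p + k) = walk_vertex v p' k"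
proof -
  show "k \<le> length p \<Longrightarrow> walk_vertex u (p @ p') k = walk_vertex u p k"
    by (auto simp: walk_vertex_def nth_append)
  show "walk_vertex u (p @ p') (length p + k) = walk_vertex v p' k"
    using assms by (induction p arbitrary: u) auto
qed

lemma pcas_append: "pcas u p v \<Longrightarrow> pcas v p' x \<Longrightarrow> pcas u (p @ p') x"
  by (induction p arbitrary: u) auto

text \<open>Expands a path \<open>P\<close> of a DAG into a walk \<open>Q\<close> of the original
  graph, arc by arc and at no extra cost. Since each \<open>R\<close> is nonempty, an arc of
  \<open>P\<close> spans a gap of at least one on \<open>Q\<close>; once \<open>Q\<close> is known
  to follow a cycle, this locates the arcs of \<open>P\<close> on that cycle.\<close>

lemma substitute_arcs:
  fixes w wD :: "'a \<times> 'a \<Rightarrow> real"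
  assumes "pcas s P t"
    and "\<And>u v. (u, v) \<in> set P \<Longrightarrow>
      \<exists>R. R \<noteq> [] \<and> pcas u R v \<and> set R \<subseteq> A \<and> sum_list (map w R) \<le> wD (u, v)"
  shows "\<exists>Q. pcas s Q t \<and> set Q \<subseteq> A \<and> sum_list (map w Q) \<le> sum_list (map wD P) \<and>
    (\<forall>u v. (u, v) \<in> set P \<longrightarrow> (\<exists>k h. 1 \<le> h \<and> k + h \<le> length Q \<and>
       walk_vertex s Q k = u \<and> walk_vertex s Q (k + h) = v))"
  using assms
proof (induction P arbitrary: s)
  case Nil
  then show ?case by (intro exI[of _ "[]"]) simp
next
  case (Cons e P)
  obtain v where e: "e = (s, v)" and P: "pcas v P t"
    using Cons.prems(1) by (cases e) auto
  obtain R where R: "R \<noteq> []" "pcas s R v" "set R \<subseteq> A" "sum_list (map w R) \<le> wD (s, v)"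
    using Cons.prems(2)[of s v] e by auto
  obtain Q where Q: "pcas v Q t" "set Q \<subseteq> A" "sum_list (map w Q) \<le> sum_list (map wD P)"
    "\<And>x y. (x, y) \<in> set P \<Longrightarrow> \<exists>k h. 1 \<le> h \<and> k + h \<le> length Q \<and>
       walk_vertex v Q k = x \<and> walk_vertex v Q (k + h) = y"
    using Cons.IH[OF P] Cons.prems(2) by auto
  note app = walk_vertex_append[OF R(2), where p' = Q]
  have "\<exists>k h. 1 \<le> h \<and> k + h \<le> length (R @ Q) \<and>
       walk_vertex s (R @ Q) k = x \<and> walk_vertex s (R @ Q) (k + h) = y"
    if "(x, y) \<in> set (e # P)" for x y
  proof (cases "(x, y) = e")
    case True
    then show ?thesis
      using R(1) app(1)[of "length R"] walk_vertex_length[OF R(2)] e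
      by (intro exI[of _ 0] exI[of _ "length R"]) (auto simp: Suc_le_eq)
  next
    case False
    with that obtain k h where kh: "1 \<le> h" "k + h \<le> length Q"
       "walk_vertex v Q k = x" "walk_vertex v Q (k + h) = y"
      using Q(4)[of x y] by auto
    then show ?thesis
      using app(2)[of k] app(2)[of "k + h"]
      by (intro exI[of _ "length R + k"] exI[of _ h]) (simp add: add.assoc)
  qed
  moreover have "pcas s (R @ Q) t" using pcas_append R(2) Q(1) by metis
  moreover have "sum_list (map w (R @ Q)) \<le> sum_list (map wD (e # P))" using R(4) Q(3) e by simp
  ultimately show ?case using R(3) Q(2) by (intro exI[of _ "R @ Q"]) auto
qed

subsection \<open>The layered graph and its cycles\<close>

locale layered_cycles =
  fixes l r :: nat
  assumes l_ge: "2 \<le> l" and r_ge: "1 \<le> r"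
begin

definition L :: nat where "L = 2 * l"
text \<open>Cycles start at coordinates below \<open>l * r\<close> and add fewer than
  \<open>l\<close> multiples of a label below \<open>r\<close>, so this size keeps them inside the
  grid.\<close>

definition q :: nat where "q = 2 * l * r"
definition lay :: "nat \<Rightarrow> nat" where "lay v = v mod L"
definition px :: "nat \<Rightarrow> int" where "px v = int (v div L mod q)"
definition py :: "nat \<Rightarrow> int" where "py v = int (v div L div q)"
definition enc :: "nat \<Rightarrow> nat \<Rightarrow> nat \<Rightarrow> nat" where "enc j x y = j + L * (x + q * y)"

text \<open>
  \<open>X j\<close> and \<open>Y j\<close> are the multiples of the two labels by which a constant-label cycle has moved
  when it reaches layer \<open>j\<close>.
\<close>

definition X :: "nat \<Rightarrow> nat" where "X j = (j + 1) div 2 mod l"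
definition Y :: "nat \<Rightarrow> nat" where "Y j = j div 2"
definition dX :: "nat \<Rightarrow> int" where "dX j = int (X (Suc j mod L)) - int (X j)"
definition dY :: "nat \<Rightarrow> int" where "dY j = int (Y (Suc j mod L)) - int (Y j)"

text \<open>Decoded coordinates always lie between \<open>0\<close> and \<open>q - 1\<close>, so a
  step that would leave the grid has no head and yields no arc.\<close>

definition arcset :: "(nat \<times> nat) set" where
  "arcset = {(u, v). u < L * q * q \<and> v < L * q * q \<and> lay v = Suc (lay u) mod L \<and>
     (\<exists>a<r. px v = px u + dX (lay u) * int a \<and> py v = py u + dY (lay u) * int a)}"

text \<open>
  Only one of \<open>dX j\<close> and \<open>dY j\<close> is nonzero, so a single label \<open>a\<close> serves both coordinates and is
  recovered from an edge by division.
\<close>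

definition lab :: "nat \<Rightarrow> nat \<Rightarrow> int" where
  "lab u v = (px v - px u + (py v - py u)) div (dX (lay u) + dY (lay u))"

text \<open>
  The summand \<open>r\<^sup>2\<close> in each weight makes a walk with \<open>L\<close> superfluous steps too expensive to be
  shortest.
\<close>

definition wt :: "nat \<times> nat \<Rightarrow> nat" where
  "wt e = r\<^sup>2 + (if lay (fst e) < L - 2 then nat ((lab (fst e) (snd e))\<^sup>2)
     else (l - 1) * nat ((int r)\<^sup>2 - (lab (fst e) (snd e))\<^sup>2))"

definition cyc :: "nat \<times> nat \<times> nat \<times> nat \<Rightarrow> nat \<Rightarrow> nat" where
  "cyc c j = (case c of (x, y, a, b) \<Rightarrow> enc j (x + X j * a) (y + Y j * b))"

definition params :: "(nat \<times> nat \<times> nat \<times> nat) set" where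
  "params = {..<l * r} \<times> {..<l * r} \<times> {..<r} \<times> {..<r}"

text \<open>The cost of every constant-label cycle: what the \<open>l - 1\<close> regular steps of a
  kind pay for their label, the last one saves, leaving \<open>r\<^sup>2\<close> per step and
  \<open>(l - 1) * r\<^sup>2\<close> for each of the two last steps.\<close>

definition W :: nat where "W = L * r\<^sup>2 + 2 * (l - 1) * r\<^sup>2"

lemma L_ge: "4 \<le> L" and L_pos: "0 < L"
  using l_ge by (auto simp: L_def)

lemma enc_dec:
  assumes "j < L" "x < q"
  shows "lay (enc j x y) = j" "px (enc j x y) = int x" "py (enc j x y) = int y"
  using assms by (auto simp: lay_def px_def py_def enc_def)

lemma enc_dec_id: "enc (lay v) (nat (px v)) (nat (py v)) = v"
  by (simp add: lay_def px_def py_def enc_def)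

lemma vertex_eqI:
  assumes "lay u = lay v" "px u = px v" "py u = py v"
  shows "u = v"
  by (metis assms enc_dec_id)

lemma enc_less:
  assumes "j < L" "x < q" "y < q"
  shows "enc j x y < L * q * q"
proof -
  have "q * Suc y \<le> q * q"
    using assms(3) by (intro mult_le_mono2) simp
  then have *: "Suc (x + q * y) \<le> q * q" using assms(2) by simp
  have "enc j x y < L * Suc (x + q * y)" using assms(1) by (simp add: enc_def)
  also have "\<dots> \<le> L * (q * q)" using * by (intro mult_le_mono2)
  finally show ?thesis by (simp add: mult.assoc)
qed

lemma lay_less: "lay v < L"
  using L_pos by (simp add: lay_def)

lemma X_even: "i < l \<Longrightarrow> X (2 * i) = i"
  by (simp add: X_def)

lemma X_odd: "i < l \<Longrightarrow> X (2 * i + 1) = Suc i mod l"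
  by (simp add: X_def)

lemma Y_even: "Y (2 * i) = i" and Y_odd: "Y (2 * i + 1) = i"
  by (simp_all add: Y_def)

lemma d_even:
  assumes "i < l - 1" shows "dX (2 * i) = 1" "dY (2 * i) = 0"
  using assms by (auto simp: dX_def dY_def L_def X_def Y_def)

lemma d_odd:
  assumes "i < l - 1" shows "dX (2 * i + 1) = 0" "dY (2 * i + 1) = 1"
  using assms by (auto simp: dX_def dY_def L_def X_def Y_def)

text \<open>The first coordinate returns one step before the walk closes, through the
  \<open>mod l\<close> in \<open>X\<close>; the second returns only at the wrap to layer
  \<open>0\<close>.\<close>

lemma d_even_last: "dX (2 * (l - 1)) = - int (l - 1)" "dY (2 * (l - 1)) = 0"
proof -
  have "Suc (2 * (l - 1)) mod L = 2 * (l - 1) + 1" using l_ge by (simp add: L_def)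
  moreover have "Suc (l - 1) mod l = 0" using l_ge by simp
  ultimately show "dX (2 * (l - 1)) = - int (l - 1)" "dY (2 * (l - 1)) = 0"
    using X_even[of "l - 1"] X_odd[of "l - 1"] Y_even[of "l - 1"] Y_odd[of "l - 1"] l_ge
    by (simp_all add: dX_def dY_def)
qed

lemma d_odd_last: "dX (2 * (l - 1) + 1) = 0" "dY (2 * (l - 1) + 1) = - int (l - 1)"
proof -
  have "Suc (2 * (l - 1) + 1) = L" using l_ge by (auto simp: L_def)
  then have "Suc (2 * (l - 1) + 1) mod L = 0" by simp
  moreover have "Suc (l - 1) mod l = 0" using l_ge by simp
  ultimately show "dX (2 * (l - 1) + 1) = 0" "dY (2 * (l - 1) + 1) = - int (l - 1)"
    using X_even[of 0] X_odd[of "l - 1"] Y_even[of 0] Y_odd[of "l - 1"] l_ge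
    by (simp_all add: dX_def dY_def)
qed

lemma layer_cases [consumes 1, case_names even even_last odd odd_last]:
  assumes "j < L"
  obtains i where "i < l - 1" "j = 2 * i" | "j = 2 * (l - 1)"
    | i where "i < l - 1" "j = 2 * i + 1" | "j = 2 * (l - 1) + 1"
proof -
  have "j = 2 * (j div 2) \<or> j = 2 * (j div 2) + 1" by presburger
  moreover have "j div 2 < l - 1 \<or> j div 2 = l - 1"
    using assms by (auto simp: L_def)
  ultimately show thesis using that by metis
qed

lemma d_neq_0:
  assumes "j < L" shows "dX j + dY j \<noteq> 0"
  using assms l_ge by (cases j rule: layer_cases) (auto simp: d_even d_odd d_even_last d_odd_last
    simp del: One_nat_def add_Suc_right)

lemma arc_facts:
  assumes "(u, v) \<in> arcset"
  shows "u < L * q * q" "v < L * q * q" "lay v = Suc (lay u) mod L"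
    and "0 \<le> lab u v" "lab u v < int r"
    and "px v = px u + dX (lay u) * lab u v" "py v = py u + dY (lay u) * lab u v"
proof -
  obtain a where a: "a < r" "px v = px u + dX (lay u) * int a" "py v = py u + dY (lay u) * int a"
    using assms by (auto simp: arcset_def)
  then have "px v - px u + (py v - py u) = (dX (lay u) + dY (lay u)) * int a"
    by (simp add: algebra_simps)
  then have "lab u v = int a"
    using d_neq_0[OF lay_less[of u]] by (simp add: lab_def)
  with a assms show "u < L * q * q" "v < L * q * q" "lay v = Suc (lay u) mod L"
    "0 \<le> lab u v" "lab u v < int r"
    "px v = px u + dX (lay u) * lab u v" "py v = py u + dY (lay u) * lab u v"
    by (auto simp: arcset_def)
qed

lemma arc_irrefl: "(u, v) \<in> arcset \<Longrightarrow> u \<noteq> v"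
  using arc_facts(3)[of u v] L_ge lay_less[of u]
  by (auto simp: mod_Suc split: if_splits)

lemma lab_sq_less:
  assumes "(u, v) \<in> arcset" shows "(lab u v)\<^sup>2 \<le> (int r)\<^sup>2"
  using arc_facts(4,5)[OF assms] by (intro power_mono) auto

text \<open>Labels are below \<open>r\<close>, so \<open>nat\<close> truncates nothing in
  \<open>wt\<close> and costs can be computed over the integers.\<close>

lemma wt_int:
  assumes "(u, v) \<in> arcset"
  shows "int (wt (u, v)) = (int r)\<^sup>2 + (if lay u < L - 2 then (lab u v)\<^sup>2
     else int (l - 1) * ((int r)\<^sup>2 - (lab u v)\<^sup>2))"
  using lab_sq_less[OF assms] by (simp add: wt_def)

lemma wt_ge: "r\<^sup>2 \<le> wt e"
  by (simp add: wt_def)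

lemma wt_le:
  assumes "e \<in> arcset" shows "wt e \<le> l * r\<^sup>2"
proof -
  obtain u v where e: "e = (u, v)" by force
  have "(if lay u < L - 2 then (lab u v)\<^sup>2 else int (l - 1) * ((int r)\<^sup>2 - (lab u v)\<^sup>2))
      \<le> int (l - 1) * (int r)\<^sup>2"
  proof -
    have "(int r)\<^sup>2 \<le> int (l - 1) * (int r)\<^sup>2"
      using l_ge by (simp add: mult_le_cancel_right1)
    moreover have "int (l - 1) * ((int r)\<^sup>2 - (lab u v)\<^sup>2) \<le> int (l - 1) * (int r)\<^sup>2"
      by (intro mult_left_mono) auto
    ultimately show ?thesis using lab_sq_less[of u v] assms e by auto
  qed
  then have "int (wt e) \<le> (int r)\<^sup>2 + int (l - 1) * (int r)\<^sup>2"
    using wt_int[of u v] assms e by simp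
  also have "\<dots> = int (l * r\<^sup>2)" using l_ge by (simp add: of_nat_diff algebra_simps)
  finally show ?thesis by (simp only: of_nat_le_iff)
qed

text \<open>An arc is determined by its tail and its label.\<close>

lemma card_arcset: "finite arcset" "card arcset \<le> L * q * q * r"
proof -
  define f where "f = (\<lambda>(u, a). (u, enc (Suc (lay u) mod L)
    (nat (px u + dX (lay u) * int a)) (nat (py u + dY (lay u) * int a))))"
  have sub: "arcset \<subseteq> f ` ({..<L * q * q} \<times> {..<r})"
  proof
    fix e assume "e \<in> arcset"
    then obtain u v a where e: "e = (u, v)" "u < L * q * q" "a < r" "lay v = Suc (lay u) mod L"
      "px v = px u + dX (lay u) * int a" "py v = py u + dY (lay u) * int a"
      by (auto simp: arcset_def)
    then have "e = f (u, a)" using enc_dec_id[of v] by (simp add: f_def)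
    moreover have "(u, a) \<in> {..<L * q * q} \<times> {..<r}" using e by simp
    ultimately show "e \<in> f ` ({..<L * q * q} \<times> {..<r})" by blast
  qed
  then show "finite arcset" by (rule finite_subset) auto
  have "card arcset \<le> card (f ` ({..<L * q * q} \<times> {..<r}))"
    using sub by (intro card_mono) auto
  also have "\<dots> \<le> card ({..<L * q * q} \<times> {..<r})" by (intro card_image_le) auto
  finally show "card arcset \<le> L * q * q * r" by simp
qed

section \<open>Closed walks of \<open>L\<close> steps and their cost\<close>

lemma closed_walk_cost:
  assumes p: "\<forall>j<L. lay (p j) = j" "\<forall>j<L. (p j, p (Suc j mod L)) \<in> arcset"
  defines "al \<equiv> \<lambda>j. lab (p j) (p (Suc j mod L))"
  shows "(\<Sum>j<L. int (wt (p j, p (Suc j mod L)))) = int W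
      + (\<Sum>i<l - 1. (al (2 * i) - al (2 * (l - 1)))\<^sup>2)
      + (\<Sum>i<l - 1. (al (2 * i + 1) - al (2 * (l - 1) + 1))\<^sup>2)" (is ?cost)
    and "\<And>i. i < l \<Longrightarrow> px (p (2 * i)) = px (p 0) + (\<Sum>i'<i. al (2 * i'))"
    and "\<And>i. i < l \<Longrightarrow> py (p (2 * i + 1)) = py (p 0) + (\<Sum>i'<i. al (2 * i' + 1))"
    and "\<And>i. i < l \<Longrightarrow> py (p (2 * i)) = py (p (2 * i + 1))"
    and "\<And>i. i < l - 1 \<Longrightarrow> px (p (2 * i + 1)) = px (p (2 * (Suc i)))"
    and "px (p (2 * (l - 1) + 1)) = px (p 0)"
proof -
  define k where "k = l - 1"
  have k: "l - 1 = k" "1 \<le> k" and lk: "\<And>i. i < l \<longleftrightarrow> i \<le> k" and Lk: "L = Suc (Suc (2 * k))"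
    using l_ge by (auto simp: k_def L_def)
  have px: "px (p (Suc j mod L)) = px (p j) + dX j * al j"
    and py: "py (p (Suc j mod L)) = py (p j) + dY j * al j" if "j < L" for j
    using arc_facts(6,7)[of "p j" "p (Suc j mod L)"] p that by (simp_all add: al_def)
  have ev: "px (p (2 * i + 1)) = px (p (2 * i)) + al (2 * i)"
    "py (p (2 * i + 1)) = py (p (2 * i))" if "i < k" for i
    using px[of "2 * i"] py[of "2 * i"] that d_even[of i, unfolded k] by (auto simp: Lk)
  have od: "px (p (2 * Suc i)) = px (p (2 * i + 1))"
    "py (p (2 * Suc i)) = py (p (2 * i + 1)) + al (2 * i + 1)" if "i < k" for i
    using px[of "2 * i + 1"] py[of "2 * i + 1"] that d_odd[of i, unfolded k] by (auto simp: Lk)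
  have evl: "px (p (2 * k + 1)) = px (p (2 * k)) - int k * al (2 * k)"
    "py (p (2 * k + 1)) = py (p (2 * k))"
    using px[of "2 * k"] py[of "2 * k"] d_even_last[unfolded k] by (auto simp: Lk)
  have odl: "px (p 0) = px (p (2 * k + 1))"
    "py (p 0) = py (p (2 * k + 1)) - int k * al (2 * k + 1)"
    using px[of "2 * k + 1"] py[of "2 * k + 1"] d_odd_last[unfolded k] by (auto simp: Lk)
  have X: "px (p (2 * i)) = px (p 0) + (\<Sum>i'<i. al (2 * i'))" if "i \<le> k" for i
    using that
  proof (induction i)
    case (Suc i)
    then show ?case using ev(1)[of i] od(1)[of i] by simp
  qed simp
  have Y0: "py (p (2 * i)) = py (p 0) + (\<Sum>i'<i. al (2 * i' + 1))" if "i \<le> k" for i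
    using that
  proof (induction i)
    case (Suc i)
    then show ?case using ev(2)[of i] od(2)[of i] by simp
  qed simp
  have Y: "py (p (2 * i)) = py (p (2 * i + 1))" if "i \<le> k" for i
    using that ev(2)[of i] evl(2) by (cases "i = k") auto
  show "\<And>i. i < l \<Longrightarrow> px (p (2 * i)) = px (p 0) + (\<Sum>i'<i. al (2 * i'))"
    using X by (simp only: lk)
  show "\<And>i. i < l \<Longrightarrow> py (p (2 * i + 1)) = py (p 0) + (\<Sum>i'<i. al (2 * i' + 1))"
    using Y Y0 by (simp only: lk)
  show "\<And>i. i < l \<Longrightarrow> py (p (2 * i)) = py (p (2 * i + 1))" using Y by (simp only: lk)
  show "\<And>i. i < l - 1 \<Longrightarrow> px (p (2 * i + 1)) = px (p (2 * (Suc i)))" using od by (simp only: k)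
  show "px (p (2 * (l - 1) + 1)) = px (p 0)" using odl by (simp only: k)
  \<comment> \<open>The last step of a kind moves back by \<open>k\<close> times its label and the
    walk closes up, so that label is the mean of the \<open>k\<close> regular ones.\<close>
  have sx: "(\<Sum>i<k. al (2 * i)) = int k * al (2 * k)"
    using X[of k] evl odl by simp
  have sy: "(\<Sum>i<k. al (2 * i + 1)) = int k * al (2 * k + 1)"
    using Y0[of k] evl odl by simp
  have c1: "int (wt (p j, p (Suc j mod L))) = (int r)\<^sup>2 + (al j)\<^sup>2" if "j < 2 * k" for j
  proof -
    have "j < L" using that Lk by simp
    with p have "(p j, p (Suc j mod L)) \<in> arcset" "lay (p j) = j" by blast+
    then show ?thesis using wt_int[of "p j" "p (Suc j mod L)"] that Lk by (simp add: al_def)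
  qed
  have c2: "int (wt (p j, p (Suc j mod L))) = (int r)\<^sup>2 + int k * ((int r)\<^sup>2 - (al j)\<^sup>2)"
    if "j = 2 * k \<or> j = 2 * k + 1" for j
  proof -
    have "j < L" using that Lk by auto
    with p have "(p j, p (Suc j mod L)) \<in> arcset" "lay (p j) = j" by blast+
    then show ?thesis using wt_int[of "p j" "p (Suc j mod L)"] that Lk k by (auto simp: al_def)
  qed
  have "(\<Sum>j<L. int (wt (p j, p (Suc j mod L)))) =
     (\<Sum>j<2*k. (int r)\<^sup>2 + (al j)\<^sup>2) + ((int r)\<^sup>2 + int k * ((int r)\<^sup>2 - (al (2 * k))\<^sup>2))
     + ((int r)\<^sup>2 + int k * ((int r)\<^sup>2 - (al (2 * k + 1))\<^sup>2))"
  proof -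
    have "(\<Sum>j<L. int (wt (p j, p (Suc j mod L)))) =
      (\<Sum>j<2*k. int (wt (p j, p (Suc j mod L)))) + int (wt (p (2*k), p (Suc (2*k) mod L)))
       + int (wt (p (2*k+1), p (Suc (2*k+1) mod L)))"
      by (subst (1) Lk) simp
    also have "(\<Sum>j<2*k. int (wt (p j, p (Suc j mod L)))) = (\<Sum>j<2*k. (int r)\<^sup>2 + (al j)\<^sup>2)"
      by (intro sum.cong) (auto simp: c1)
    finally show ?thesis using c2[of "2 * k"] c2[of "2 * k + 1"] by simp
  qed
  also have "\<dots> = int W + ((\<Sum>i<k. (al (2 * i))\<^sup>2) - int k * (al (2 * k))\<^sup>2)
      + ((\<Sum>i<k. (al (2 * i + 1))\<^sup>2) - int k * (al (2 * k + 1))\<^sup>2)"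
    unfolding W_def Lk k sum.distrib sum_lessThan_double by (simp add: algebra_simps)
  also have "\<dots> = int W + (\<Sum>i<k. (al (2 * i) - al (2 * k))\<^sup>2)
      + (\<Sum>i<k. (al (2 * i + 1) - al (2 * k + 1))\<^sup>2)"
    by (simp only: sum_square_about_mean[OF sx] sum_square_about_mean[OF sy])
  finally show ?cost by (simp only: k)
qed

text \<open>The excess over \<open>W\<close> is a sum of squares, so all labels of a kind agree and
  the positions are multiples of the common label.\<close>

lemma closed_walk_minimal:
  assumes p: "\<forall>j<L. lay (p j) = j" "\<forall>j<L. (p j, p (Suc j mod L)) \<in> arcset"
    and le: "(\<Sum>j<L. wt (p j, p (Suc j mod L))) \<le> W"
  shows "\<exists>a b. \<forall>j<L. px (p j) = px (p 0) + int (X j) * a \<and> py (p j) = py (p 0) + int (Y j) * b"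
proof -
  define al where "al j = lab (p j) (p (Suc j mod L))" for j
  note cw = closed_walk_cost[OF p, folded al_def]
  define a b where "a = al (2 * (l - 1))" and "b = al (2 * (l - 1) + 1)"
  have "(\<Sum>j<L. int (wt (p j, p (Suc j mod L)))) \<le> int W"
    using le by (simp flip: of_nat_sum)
  then have "(\<Sum>i<l - 1. (al (2 * i) - a)\<^sup>2) + (\<Sum>i<l - 1. (al (2 * i + 1) - b)\<^sup>2) \<le> 0"
    using cw(1) unfolding a_def b_def by linarith
  moreover have "0 \<le> (\<Sum>i<l - 1. (al (2 * i) - a)\<^sup>2)" "0 \<le> (\<Sum>i<l - 1. (al (2 * i + 1) - b)\<^sup>2)"
    by (intro sum_nonneg; simp)+
  ultimately have "(\<Sum>i<l - 1. (al (2 * i) - a)\<^sup>2) = 0" "(\<Sum>i<l - 1. (al (2 * i + 1) - b)\<^sup>2) = 0"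
    by linarith+
  then have al: "al (2 * i) = a" "al (2 * i + 1) = b" if "i < l - 1" for i
    using that by (simp_all add: sum_nonneg_eq_0_iff)
  have x: "px (p (2 * i)) = px (p 0) + int i * a" if "i < l" for i
  proof -
    have "(\<Sum>i'<i. al (2 * i')) = (\<Sum>i'<i. a)" using al that by (intro sum.cong) auto
    then show ?thesis using cw(2)[OF that] by simp
  qed
  have y: "py (p (2 * i + 1)) = py (p 0) + int i * b" if "i < l" for i
  proof -
    have "(\<Sum>i'<i. al (2 * i' + 1)) = (\<Sum>i'<i. b)" using al that by (intro sum.cong) auto
    then show ?thesis using cw(3)[OF that] by simp
  qed
  have "px (p j) = px (p 0) + int (X j) * a \<and> py (p j) = py (p 0) + int (Y j) * b" if "j < L" for j
    using that
  proof (cases j rule: layer_cases)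
    case (even i)
    then show ?thesis using x[of i] y[of i] cw(4)[of i] by (simp add: X_even Y_even)
  next
    case even_last
    then show ?thesis using x[of "l-1"] y[of "l-1"] cw(4)[of "l-1"] l_ge by (simp add: X_even Y_even)
  next
    case (odd i)
    then show ?thesis using x[of "Suc i"] y[of i] cw(5)[of i] X_odd[of i] Y_odd[of i] by simp
  next
    case odd_last
    then show ?thesis using y[of "l-1"] cw(6) l_ge X_odd[of "l-1"] Y_odd[of "l-1"] by simp
  qed
  then show ?thesis by blast
qed

section \<open>The constant-label cycles\<close>

lemma X_less: "X j < l"
  using l_ge by (simp add: X_def)

lemma Y_less: "j < L \<Longrightarrow> Y j < l"
  by (auto simp: Y_def L_def)

lemma coord_less:
  assumes "x < l * r" "a < r" "m < l" shows "x + m * a < q"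
proof -
  have "m * a \<le> l * r" using assms by (intro mult_le_mono) auto
  then show ?thesis using assms by (simp add: q_def)
qed

lemma cyc_dec:
  assumes "(x, y, a, b) \<in> params" "j < L"
  shows "lay (cyc (x, y, a, b) j) = j" "px (cyc (x, y, a, b) j) = int x + int (X j) * int a"
    "py (cyc (x, y, a, b) j) = int y + int (Y j) * int b" "cyc (x, y, a, b) j < L * q * q"
  using assms coord_less[of x a "X j"] coord_less[of y b "Y j"] X_less[of j] Y_less[of j]
  by (auto simp: params_def cyc_def enc_dec enc_less)

lemma lay_cyc: "c \<in> params \<Longrightarrow> j < L \<Longrightarrow> lay (cyc c j) = j"
  by (cases c) (simp add: cyc_dec)

lemma cyc_arc:
  assumes "c \<in> params" "j < L"
  shows "(cyc c j, cyc c (Suc j mod L)) \<in> arcset"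
proof -
  obtain x y a b where c: "c = (x, y, a, b)" by (cases c)
  have j': "Suc j mod L < L" using L_pos by simp
  note d = cyc_dec[OF assms(1)[unfolded c] assms(2)] cyc_dec[OF assms(1)[unfolded c] j']
  have ab: "a < r" "b < r" using assms c by (auto simp: params_def)
  \<comment> \<open>\<open>arcset\<close> wants one label for both coordinates; at each layer one
    displacement vanishes, so either \<open>a\<close> or \<open>b\<close> serves.\<close>
  have "\<exists>e<r. dX j * int a = dX j * int e \<and> dY j * int b = dY j * int e"
    using assms(2)
  proof (cases j rule: layer_cases)
    case (even i) then show ?thesis using ab d_even by auto
  next
    case even_last then show ?thesis using ab d_even_last by auto
  next
    case (odd i) then show ?thesis using ab d_odd by auto
  next
    case odd_last then show ?thesis using ab d_odd_last by auto
  qed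
  moreover have "px (cyc c (Suc j mod L)) = px (cyc c j) + dX j * int a"
    "py (cyc c (Suc j mod L)) = py (cyc c j) + dY j * int b"
    using d c by (simp_all add: dX_def dY_def algebra_simps)
  ultimately show ?thesis using d c by (auto simp: arcset_def)
qed

text \<open>The labels along the cycle are constant, so both sums of squares in
  \<open>closed_walk_cost\<close> vanish.\<close>

lemma cyc_cost:
  assumes "c \<in> params"
  shows "(\<Sum>j<L. wt (cyc c j, cyc c (Suc j mod L))) = W"
proof -
  obtain x y a b where c: "c = (x, y, a, b)" by (cases c)
  define al where "al j = lab (cyc c j) (cyc c (Suc j mod L))" for j
  \<comment> \<open>The factors \<open>dX j\<close> and \<open>dY j\<close> stay because at each
    layer one of them is zero and says nothing about its label.\<close>
  have e: "dX j * int a = dX j * al j" "dY j * int b = dY j * al j" if "j < L" for j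
  proof -
    have j': "Suc j mod L < L" using L_pos by simp
    note d = cyc_dec[OF assms[unfolded c] that] cyc_dec[OF assms[unfolded c] j']
    show "dX j * int a = dX j * al j" "dY j * int b = dY j * al j"
      using arc_facts(6,7)[OF cyc_arc[OF assms that]] d c
      by (simp_all add: al_def dX_def dY_def algebra_simps)
  qed
  have "al (2 * i) = int a" if "i < l - 1" for i
    using e(1)[of "2 * i"] that d_even[of i] by (simp add: L_def)
  moreover have "al (2 * i + 1) = int b" if "i < l - 1" for i
    using e(2)[of "2 * i + 1"] that d_odd[of i] by (simp add: L_def)
  moreover have "al (2 * (l - 1)) = int a"
    using e(1)[of "2 * (l - 1)"] l_ge d_even_last by (simp add: L_def)
  moreover have "al (2 * (l - 1) + 1) = int b"
    using e(2)[of "2 * (l - 1) + 1"] l_ge d_odd_last by (simp add: L_def)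
  moreover note closed_walk_cost(1)[of "cyc c", folded al_def] lay_cyc[OF assms] cyc_arc[OF assms]
  ultimately have "(\<Sum>j<L. int (wt (cyc c j, cyc c (Suc j mod L)))) = int W"
    by simp
  then show ?thesis by (simp flip: of_nat_sum)
qed

section \<open>Two non-adjacent vertices determine a cycle\<close>

definition nonadj :: "nat \<Rightarrow> nat \<Rightarrow> bool" where
  "nonadj i j \<longleftrightarrow> i < L \<and> j < L \<and> i \<noteq> j \<and> j \<noteq> Suc i mod L \<and> i \<noteq> Suc j mod L"

text \<open>\<open>Y\<close> takes each value on a pair of layers \<open>2 * i\<close>,
  \<open>2 * i + 1\<close>, and \<open>X\<close> on a pair \<open>2 * i - 1\<close>,
  \<open>2 * i\<close> modulo \<open>L\<close>; all these pairs are adjacent.\<close>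

lemma nonadj_separates:
  assumes "nonadj i j" shows "X i \<noteq> X j" "Y i \<noteq> Y j"
proof -
  have ij: "i < L" "j < L" "i \<noteq> j" "j \<noteq> Suc i mod L" "i \<noteq> Suc j mod L"
    using assms by (auto simp: nonadj_def)
  have ne: "i \<noteq> j" "j \<noteq> Suc i" "i \<noteq> Suc j" "\<not> (i = 0 \<and> j = L - 1)" "\<not> (j = 0 \<and> i = L - 1)"
    using ij L_ge by auto
  show "Y i \<noteq> Y j" unfolding Y_def using ne(1-3) by linarith
  have *: "X j = (if j = L - 1 then 0 else (j + 1) div 2)" if "j < L" for j
  proof (cases "j = L - 1")
    case True
    then have "(j + 1) div 2 = l" using L_ge by (simp add: L_def)
    then show ?thesis using True by (simp add: X_def)
  next
    case False
    then have "(j + 1) div 2 < l" using that by (auto simp: L_def)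
    then show ?thesis using False by (simp add: X_def)
  qed
  have d: "(i + 1) div 2 \<noteq> (j + 1) div 2" using ne(1-3) by linarith
  show "X i \<noteq> X j"
  proof (cases "i = L - 1 \<or> j = L - 1")
    case False
    then show ?thesis using d *[OF ij(1)] *[OF ij(2)] by simp
  next
    case True
    then have "X i = 0 \<and> 0 < X j \<or> 0 < X i \<and> X j = 0"
    proof
      assume i: "i = L - 1"
      then have "j \<noteq> 0" "j \<noteq> L - 1" using ne(1,4,5) by simp_all
      then show ?thesis using i *[OF ij(1)] *[OF ij(2)] by simp
    next
      assume j: "j = L - 1"
      then have "i \<noteq> 0" "i \<noteq> L - 1" using ne(1,4,5) by simp_all
      then show ?thesis using j *[OF ij(1)] *[OF ij(2)] by simp
    qed
    then show ?thesis by linarith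
  qed
qed

lemma affine_eq_two_points:
  fixes s t x x' a a' :: int
  assumes "x + s * a = x' + s * a'" "x + t * a = x' + t * a'" "s \<noteq> t"
  shows "x = x' \<and> a = a'"
proof -
  have "(s - t) * (a - a') = 0" using assms(1,2) by (simp add: algebra_simps)
  then have "a = a'" using assms(3) by simp
  then show ?thesis using assms(1) by simp
qed

text \<open>The coordinates of a cycle are affine in \<open>X j\<close> and \<open>Y j\<close>,
  which differ at non-adjacent layers, so the values there fix offsets and labels.\<close>

lemma cyc_eqI:
  assumes "c \<in> params" "c' \<in> params" "nonadj i j" "cyc c i = cyc c' i" "cyc c j = cyc c' j"
  shows "c = c'"
proof -
  obtain x y a b x' y' a' b' where c: "c = (x, y, a, b)" "c' = (x', y', a', b')"
    by (cases c, cases c')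
  have ij: "i < L" "j < L" using assms(3) by (auto simp: nonadj_def)
  have "int x + int (X i) * int a = int x' + int (X i) * int a'"
    "int y + int (Y i) * int b = int y' + int (Y i) * int b'"
    "int x + int (X j) * int a = int x' + int (X j) * int a'"
    "int y + int (Y j) * int b = int y' + int (Y j) * int b'"
    using cyc_dec[OF assms(1)[unfolded c] ij(1)] cyc_dec[OF assms(2)[unfolded c] ij(1)]
      cyc_dec[OF assms(1)[unfolded c] ij(2)] cyc_dec[OF assms(2)[unfolded c] ij(2)] assms(4,5) c
    by simp_all
  then have "int x = int x' \<and> int a = int a'" "int y = int y' \<and> int b = int b'"
    using affine_eq_two_points[of "int x" "int (X i)" "int a" "int x'" "int a'" "int (X j)"]
      affine_eq_two_points[of "int y" "int (Y i)" "int b" "int y'" "int b'" "int (Y j)"]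
      nonadj_separates[OF assms(3)] by simp_all
  then show ?thesis using c by simp
qed

text \<open>By \<open>closed_walk_minimal\<close> the coordinates of \<open>z\<close> are affine
  like those of a cycle, and they agree with those of \<open>c\<close> at two distinct
  arguments.\<close>

lemma closed_walk_eq_cyc:
  assumes c: "c \<in> params" and "nonadj i j" and s: "s < L"
    and z: "\<forall>k<L. lay (z k) = (s + k) mod L"
    and arc: "\<forall>k<L. (z k, z (Suc k mod L)) \<in> arcset"
    and le: "(\<Sum>k<L. wt (z k, z (Suc k mod L))) \<le> W"
    and eq: "cyc c i \<in> z ` {..<L}" "cyc c j \<in> z ` {..<L}"
    and k: "k < L"
  shows "z k = cyc c ((s + k) mod L)"
proof -
  \<comment> \<open>Re-indexes \<open>z\<close> by layer; \<open>L - s + j\<close> stands for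
    \<open>j - s\<close> and avoids truncated subtraction.\<close>
  define p where "p = (\<lambda>j. z ((L - s + j) mod L))"
  have p_z: "p ((s + k) mod L) = z k" if "k < L" for k
  proof -
    have "(L - s + (s + k) mod L) mod L = (L - s + (s + k)) mod L" by (simp add: mod_simps)
    also have "\<dots> = k" using that s by simp
    finally show ?thesis by (simp add: p_def)
  qed
  have p_Suc: "p (Suc j mod L) = z (Suc ((L - s + j) mod L) mod L)" for j
    by (simp add: p_def mod_simps)
  have mL: "(L - s + j) mod L < L" for j using L_pos by simp
  have p1: "lay (p j) = j" if "j < L" for j
  proof -
    have "lay (p j) = (s + (L - s + j) mod L) mod L" using z[rule_format, OF mL] by (simp add: p_def)
    also have "\<dots> = (s + (L - s + j)) mod L" by (simp add: mod_simps)
    also have "\<dots> = j" using that s by simp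
    finally show ?thesis .
  qed
  have p2: "(p j, p (Suc j mod L)) \<in> arcset" for j
    unfolding p_Suc using arc[rule_format, OF mL] by (simp add: p_def)
  have "(\<Sum>j<L. wt (p j, p (Suc j mod L)))
      = (\<Sum>j<L. (\<lambda>k. wt (z k, z (Suc k mod L))) ((L - s + j) mod L))"
    unfolding p_Suc by (simp add: p_def)
  also have "\<dots> \<le> W" using le by (subst sum_rotate[OF L_pos])
  finally obtain A B where AB: "\<And>j. j < L \<Longrightarrow> px (p j) = px (p 0) + int (X j) * A"
    "\<And>j. j < L \<Longrightarrow> py (p j) = py (p 0) + int (Y j) * B"
    using closed_walk_minimal[of p] p1 p2 by metis
  obtain x y a b where cc: "c = (x, y, a, b)" by (cases c)
  note d = cyc_dec[OF c[unfolded cc], folded cc]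
  have ij: "i < L" "j < L" using assms(2) by (auto simp: nonadj_def)
  have pc: "p j = cyc c j" if "cyc c j \<in> z ` {..<L}" "j < L" for j
  proof -
    obtain k where k: "k < L" "cyc c j = z k" using \<open>cyc c j \<in> _\<close> by auto
    have "j = (s + k) mod L" using z[rule_format, OF k(1)] k(2) lay_cyc[OF c \<open>j < L\<close>] by simp
    then show ?thesis using p_z[rule_format, OF k(1)] k(2) by simp
  qed
  have "px (p 0) + int (X i) * A = int x + int (X i) * int a"
    "px (p 0) + int (X j) * A = int x + int (X j) * int a"
    "py (p 0) + int (Y i) * B = int y + int (Y i) * int b"
    "py (p 0) + int (Y j) * B = int y + int (Y j) * int b"
    using AB[OF ij(1)] AB[OF ij(2)] pc[OF eq(1) ij(1)] pc[OF eq(2) ij(2)] d[OF ij(1)] d[OF ij(2)]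
    by simp_all
  then have xyab: "px (p 0) = int x \<and> A = int a" "py (p 0) = int y \<and> B = int b"
    using affine_eq_two_points[of "px (p 0)" "int (X i)" A "int x" "int a" "int (X j)"]
      affine_eq_two_points[of "py (p 0)" "int (Y i)" B "int y" "int b" "int (Y j)"]
      nonadj_separates[OF assms(2)] by simp_all
  have pcyc: "p j = cyc c j" if "j < L" for j
  proof (rule vertex_eqI)
    show "lay (p j) = lay (cyc c j)" using p1[OF that] d(1)[OF that] by simp
    show "px (p j) = px (cyc c j)" unfolding AB(1)[OF that] d(2)[OF that] using xyab by simp
    show "py (p j) = py (cyc c j)" unfolding AB(2)[OF that] d(3)[OF that] using xyab by simp
  qed
  have "(s + k) mod L < L" using L_pos by simp
  then show ?thesis using pcyc p_z[OF k] by metis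
qed

subsection \<open>Distances and DAG covers of the layered graph\<close>

text \<open>Vertices from \<open>L * q * q\<close> on are isolated; they pad the graph to any larger
  size.\<close>

definition graph :: "nat \<Rightarrow> nat pair_pre_digraph" where
  "graph n = \<lparr>pverts = {..<n}, parcs = arcset\<rparr>"

lemma graph_simps [simp]: "pverts (graph n) = {..<n}" "parcs (graph n) = arcset"
  by (simp_all add: graph_def)

lemma pair_digraph_graph:
  assumes "L * q * q \<le> n" shows "pair_digraph (graph n)"
proof
  fix e assume e: "e \<in> parcs (graph n)"
  obtain u v where uv: "e = (u, v)" by force
  show "fst e \<in> pverts (graph n)" "snd e \<in> pverts (graph n)" "fst e \<noteq> snd e"
    using arc_facts(1,2)[of u v] arc_irrefl[of u v] e uv assms by auto
qed (use card_arcset in auto)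

section \<open>Arcs of cycles are unique shortest paths\<close>

lemma lay_walk:
  assumes "pcas u p v" "set p \<subseteq> arcset" "k \<le> length p"
  shows "lay (walk_vertex u p k) = (lay u + k) mod L"
  using assms(3)
proof (induction k)
  case 0
  then show ?case using lay_less[of u] by simp
next
  case (Suc k)
  have "(walk_vertex u p k, walk_vertex u p (Suc k)) \<in> arcset"
    using pcas_nth[OF assms(1), of k] assms(2) Suc.prems by (metis Suc_le_eq nth_mem subsetD)
  then show ?case using arc_facts(3) Suc by (simp add: mod_simps)
qed

lemma nonadj_shift:
  assumes "a < L" "2 \<le> h" "h \<le> L - 2" shows "nonadj a ((a + h) mod L)"
proof -
  have Suc: "Suc x mod L = (if Suc x = L then 0 else Suc x)" if "x < L" for x
    using that by simp
  define b where "b = (a + h) mod L"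
  have b: "b < L" using L_pos by (simp add: b_def)
  have "b = a + h \<or> b + L = a + h"
  proof (cases "a + h < L")
    case False
    then have "a + h - L < L" using assms by linarith
    then show ?thesis using False by (simp add: b_def le_mod_geq)
  qed (simp add: b_def)
  then have "a \<noteq> b \<and> b \<noteq> Suc a mod L \<and> a \<noteq> Suc b mod L"
    unfolding Suc[OF assms(1)] Suc[OF b] using assms b by (simp split: if_split) linarith
  then show ?thesis using assms(1) b by (simp add: nonadj_def b_def)
qed

text \<open>Indices may exceed \<open>L\<close>, so an arc that wraps around layer \<open>0\<close>
  is still a range of consecutive indices.\<close>

definition cyc_step :: "nat \<times> nat \<times> nat \<times> nat \<Rightarrow> nat \<Rightarrow> nat \<times> nat" where
  "cyc_step c k = (cyc c (k mod L), cyc c (Suc k mod L))"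

lemma cyc_less: "c \<in> params \<Longrightarrow> j < L \<Longrightarrow> cyc c j < L * q * q"
  by (cases c) (simp add: cyc_dec)

lemma cyc_step_arc: "c \<in> params \<Longrightarrow> cyc_step c k \<in> arcset"
  using cyc_arc[of c "k mod L"] L_pos by (simp add: cyc_step_def mod_Suc_eq)

lemma cyc_step_cost:
  assumes "c \<in> params" shows "(\<Sum>k<L. wt (cyc_step c (s + k))) = W"
proof -
  have "(\<Sum>k<L. wt (cyc_step c (s + k)))
      = (\<Sum>k<L. (\<lambda>j. wt (cyc c j, cyc c (Suc j mod L))) ((s + k) mod L))"
    by (simp add: cyc_step_def mod_Suc_eq)
  also have "\<dots> = W" by (subst sum_rotate[OF L_pos]) (rule cyc_cost[OF assms])
  finally show ?thesis .
qed

lemma cyc_step_walk: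
  "pcas (cyc c (s mod L)) (map (\<lambda>k. cyc_step c (s + k)) [0..<m]) (cyc c ((s + m) mod L))"
  by (induction m) (auto simp: cyc_step_def intro!: pcas_append)

text \<open>Layers fix the length of \<open>Q\<close> modulo \<open>L\<close>, and extra rounds are
  too expensive. Adding the two missing edges of the cycle gives a closed walk of \<open>L\<close>
  steps and cost at most \<open>W\<close> through two non-adjacent vertices of the cycle, so
  \<open>closed_walk_eq_cyc\<close> applies.\<close>

lemma arc_unique:
  assumes c: "c \<in> params" and s: "s < L"
    and Q: "pcas (cyc c s) Q (cyc c ((s + (L - 2)) mod L))" "set Q \<subseteq> arcset"
    and le: "sum_list (map wt Q) \<le> (\<Sum>k<L - 2. wt (cyc_step c (s + k)))"
  shows "length Q = L - 2" "k \<le> L - 2 \<Longrightarrow> walk_vertex (cyc c s) Q k = cyc c ((s + k) mod L)"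
proof -
  define u where "u = cyc c s"
  have sum_last2: "sum f {..<L} = sum f {..<L - 2} + f (L - 2) + f (L - 1)" for f :: "nat \<Rightarrow> nat"
  proof -
    have "sum f {..<Suc (Suc (L - 2))} = sum f {..<L - 2} + f (L - 2) + f (Suc (L - 2))" by simp
    moreover have "Suc (L - 2) = L - 1" "Suc (L - 1) = L" using L_ge by simp_all
    ultimately show ?thesis by metis
  qed
  have total: "(\<Sum>k<L - 2. wt (cyc_step c (s + k))) + wt (cyc_step c (s + (L - 2)))
      + wt (cyc_step c (s + (L - 1))) = W"
    using cyc_step_cost[OF c, of s] sum_last2[of "\<lambda>k. wt (cyc_step c (s + k))"] by simp
  have "lay (cyc c ((s + (L - 2)) mod L)) = (s + length Q) mod L"
    using lay_walk[OF Q, of "length Q"] walk_vertex_length[OF Q(1)] lay_cyc[OF c s] by simp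
  then have "(s + (L - 2)) mod L = (s + length Q) mod L"
    using lay_cyc[OF c, of "(s + (L - 2)) mod L"] L_pos by simp
  then have "(L - s + (s + (L - 2))) mod L = (L - s + (s + length Q)) mod L"
    by (metis mod_add_right_eq)
  moreover have "L - s + (s + (L - 2)) = L - 2 + L" "L - s + (s + length Q) = length Q + L"
    using s by simp_all
  ultimately have "(L - 2 + L) mod L = (length Q + L) mod L" by simp
  then have "length Q mod L = L - 2" using L_pos by (simp only: mod_add_self2) simp
  then have len: "length Q = L - 2 + L * (length Q div L)"
    by (metis add.commute mult_div_mod_eq)
  \<comment> \<open>A further round means at least \<open>2 * L - 2\<close> arcs of weight at least
    \<open>r\<^sup>2\<close>, which already costs \<open>W\<close>; the arc of the cycle costs
    strictly less, as the missing edges have positive weight.\<close>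
  have "length Q div L = 0"
  proof (rule ccontr)
    assume "length Q div L \<noteq> 0"
    then have "L * 1 \<le> L * (length Q div L)" by (intro mult_le_mono2) simp
    then have "2 * L - 2 \<le> length Q" using len L_ge by linarith
    then have "(2 * L - 2) * r\<^sup>2 \<le> length Q * r\<^sup>2" by (rule mult_le_mono1)
    also have "length Q * r\<^sup>2 \<le> sum_list (map wt Q)"
    proof (induction Q)
      case (Cons e Q)
      then show ?case using wt_ge[of e] by simp
    qed simp
    also note le
    also have "(\<Sum>k<L - 2. wt (cyc_step c (s + k))) < W"
    proof -
      have "0 < r\<^sup>2" using r_ge by simp
      then have "0 < wt (cyc_step c (s + (L - 2)))" using wt_ge less_le_trans by blast
      then show ?thesis using total by linarith
    qed
    also have "W = (2 * L - 2) * r\<^sup>2"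
    proof -
      have "L + 2 * (l - 1) = 2 * L - 2" using L_ge by (simp add: L_def)
      then show ?thesis by (simp only: W_def flip: add_mult_distrib)
    qed
    finally show False by simp
  qed
  then show len: "length Q = L - 2" using len by simp
  \<comment> \<open>\<open>Q\<close> fills positions \<open>0\<close> to \<open>L - 2\<close>; the
    one remaining vertex is taken from the cycle.\<close>
  define z where "z = (\<lambda>k. if k \<le> L - 2 then walk_vertex u Q k else cyc c ((s + k) mod L))"
  have zt: "z (L - 2) = cyc c ((s + (L - 2)) mod L)" and z0: "z 0 = cyc c s"
    using walk_vertex_length[OF Q(1)] len by (simp_all add: z_def u_def)
  have zl: "z (L - 1) = cyc c ((s + (L - 1)) mod L)"
  proof -
    have "\<not> L - 1 \<le> L - 2" using L_ge by linarith
    then show ?thesis by (simp only: z_def if_False)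
  qed
  have step: "(z k, z (Suc k mod L)) = Q ! k" if "k < L - 2" for k
    using pcas_nth[OF Q(1), of k] that len by (simp add: z_def u_def)
  have step1: "(z (L - 2), z (Suc (L - 2) mod L)) = cyc_step c (s + (L - 2))"
  proof -
    have "Suc (L - 2) mod L = L - 1" "s + (L - 1) = Suc (s + (L - 2))" using L_ge by simp_all
    then show ?thesis using zt zl by (simp add: cyc_step_def)
  qed
  have step2: "(z (L - 1), z (Suc (L - 1) mod L)) = cyc_step c (s + (L - 1))"
  proof -
    have "Suc (L - 1) mod L = 0" "Suc (s + (L - 1)) mod L = s" using L_ge s by simp_all
    then show ?thesis using z0 zl by (simp add: cyc_step_def)
  qed
  have arc: "(z k, z (Suc k mod L)) \<in> arcset" if kL: "k < L" for k
  proof -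
    consider "k < L - 2" | "k = L - 2" | "k = L - 1" using kL by linarith
    then show ?thesis
    proof cases
      case 1
      then show ?thesis using step[OF 1] Q(2) len by (metis nth_mem subsetD)
    qed (use step1 step2 cyc_step_arc[OF c] in metis)+
  qed
  have lay: "lay (z k) = (s + k) mod L" if "k < L" for k
  proof (cases "k \<le> L - 2")
    case True
    then show ?thesis
      using lay_walk[OF Q, of k] len lay_cyc[OF c s] by (simp add: z_def u_def)
  next
    case False
    then show ?thesis using lay_cyc[OF c] L_pos by (simp add: z_def)
  qed
  have sumQ: "sum_list (map wt Q) = (\<Sum>k<L - 2. wt (z k, z (Suc k mod L)))"
  proof -
    have "sum_list (map wt Q) = (\<Sum>k<L - 2. wt (Q ! k))"
      by (simp add: sum_list_sum_nth len atLeast0LessThan)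
    also have "\<dots> = (\<Sum>k<L - 2. wt (z k, z (Suc k mod L)))"
      by (rule sum.cong[OF refl]) (simp only: step lessThan_iff)
    finally show ?thesis .
  qed
  have "(\<Sum>k<L. wt (z k, z (Suc k mod L))) = (\<Sum>k<L - 2. wt (z k, z (Suc k mod L)))
      + wt (z (L - 2), z (Suc (L - 2) mod L)) + wt (z (L - 1), z (Suc (L - 1) mod L))"
    by (rule sum_last2)
  then have "(\<Sum>k<L. wt (z k, z (Suc k mod L))) \<le> W"
    using sumQ le total by (simp only: step1 step2)
  moreover have "cyc c s \<in> z ` {..<L}" "cyc c ((s + (L - 2)) mod L) \<in> z ` {..<L}"
    using z0 zt L_ge by (metis image_eqI lessThan_iff L_pos,
      metis image_eqI lessThan_iff L_pos diff_less zero_less_numeral)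
  moreover have "\<forall>k<L. lay (z k) = (s + k) mod L" "\<forall>k<L. (z k, z (Suc k mod L)) \<in> arcset"
    using lay arc by blast+
  moreover have "nonadj s ((s + (L - 2)) mod L)"
    using L_ge by (intro nonadj_shift[OF s]) linarith+
  ultimately have zc: "z k = cyc c ((s + k) mod L)" if "k < L" for k
    using closed_walk_eq_cyc[OF c _ s] that by blast
  show "walk_vertex (cyc c s) Q k = cyc c ((s + k) mod L)" if "k \<le> L - 2"
  proof -
    have "k < L" using that L_ge by linarith
    from zc[OF this] show ?thesis using that by (simp only: z_def u_def if_True)
  qed
qed

section \<open>DAGs covering the arcs of a cycle\<close>

lemma card_params: "finite params" "card params = (l * r)\<^sup>2 * r\<^sup>2"
  by (simp_all add: params_def power2_eq_square)

text \<open>A shortest path of \<open>D\<close>, expanded into a walk of the graph, is the unique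
  shortest path, so its arcs join vertices of the cycle. An arc skipping a layer would join
  non-adjacent vertices; by \<open>extra\<close> it would lie in \<open>arcset\<close>, whose arcs
  advance one layer only. So the path is the arc of the cycle itself.\<close>

lemma covered_arc:
  assumes n: "L * q * q \<le> n" and c: "c \<in> params" and s: "s < L"
    and D: "pair_digraph D" "acyclic (parcs D)" "pverts D = {..<n}"
    and ge: "\<And>u v. u < n \<Longrightarrow> v < n \<Longrightarrow>
      weighted_dist (graph n) (\<lambda>e. real (wt e)) u v \<le> weighted_dist D wD u v"
    and eq: "weighted_dist D wD (cyc c s) (cyc c ((s + (L - 2)) mod L)) =
      weighted_dist (graph n) (\<lambda>e. real (wt e)) (cyc c s) (cyc c ((s + (L - 2)) mod L))"
    and extra: "\<And>i j. nonadj i j \<Longrightarrow> (cyc c i, cyc c j) \<in> parcs D \<Longrightarrow> (cyc c i, cyc c j) \<in> arcset"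
    and k: "k < L - 2"
  shows "cyc_step c (s + k) \<in> parcs D"
proof -
  interpret G: pair_digraph "graph n" by (rule pair_digraph_graph[OF n])
  interpret D: pair_digraph D by (rule D(1))
  let ?w = "\<lambda>e. real (wt e)"
  define u v where "u = cyc c s" and "v = cyc c ((s + (L - 2)) mod L)"
  define cost where "cost = (\<Sum>k<L - 2. wt (cyc_step c (s + k)))"
  have Gnn: "0 \<le> G.awalk_cost ?w p" for p
    by (auto simp: G.awalk_cost_def intro!: sum_list_nonneg)
  have un: "u < n"
    using cyc_less[OF c s] n by (simp add: u_def)
  let ?C = "map (\<lambda>k. cyc_step c (s + k)) [0..<L - 2]"
  have "G.awalk u ?C v"
    unfolding G.awalk_def using un cyc_step_arc[OF c] cyc_step_walk[of c s "L - 2"] s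
    by (auto simp: u_def v_def)
  moreover have "G.awalk_cost ?w ?C = real cost"
    by (simp add: G.awalk_cost_def comp_def cost_def interv_sum_list_conv_sum_set_nat atLeast0LessThan)
  ultimately have "G.\<mu> ?w u v \<le> ereal (real cost)"
    using G.min_cost_le_walk_cost by metis
  then have "D.\<mu> wD u v \<le> ereal (real cost)" using eq by (simp add: u_def v_def)
  moreover have "0 \<le> D.awalk_cost wD p" if "D.awalk x p x" for x p
    using D.acyclic_closed_awalk[OF D(2) that] by simp
  ultimately obtain P where P: "D.awalk u P v" "D.awalk_cost wD P \<le> real cost"
    using D.dist_attained by metis
  have Pc: "pcas u P v" "set P \<subseteq> parcs D" using P(1) by (auto simp: D.awalk_def)
  have "\<exists>R. R \<noteq> [] \<and> pcas x R y \<and> set R \<subseteq> arcset \<and> sum_list (map ?w R) \<le> wD (x, y)"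
    if "(x, y) \<in> set P" for x y
  proof -
    have xy: "(x, y) \<in> parcs D" using that Pc by auto
    then have n: "x < n" "y < n" using D.wellformed'[of x y] D(3) by auto
    \<comment> \<open>A single arc is a walk, so its weight is at least the distance in
      \<open>D\<close>, hence by \<open>ge\<close> the distance in the graph, which some walk
      \<open>R\<close> attains.\<close>
    have "D.awalk x [(x, y)] y" using xy n D(3) by (simp add: D.awalk_def)
    then have "D.\<mu> wD x y \<le> ereal (wD (x, y))"
      using D.min_cost_le_walk_cost[of x "[(x, y)]" y wD] by (simp add: D.awalk_cost_def)
    then have "G.\<mu> ?w x y \<le> ereal (wD (x, y))" using ge[OF n] by (rule order_trans[rotated])
    then obtain R where R: "G.awalk x R y" "G.awalk_cost ?w R \<le> wD (x, y)"
      using G.dist_attained[of ?w x y] Gnn by metis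
    have "x \<noteq> y" using D.pair_no_loops[OF xy] by simp
    then have "R \<noteq> []" using R(1) by (auto simp: G.awalk_def)
    then show ?thesis using R by (auto simp: G.awalk_def G.awalk_cost_def)
  qed
  from substitute_arcs[OF Pc(1) this]
  obtain Q where Q: "pcas u Q v" "set Q \<subseteq> arcset" "sum_list (map ?w Q) \<le> sum_list (map wD P)"
    and sub: "\<And>x y. (x, y) \<in> set P \<Longrightarrow> \<exists>k h. 1 \<le> h \<and> k + h \<le> length Q \<and>
       walk_vertex u Q k = x \<and> walk_vertex u Q (k + h) = y"
    by auto
  have "real (sum_list (map wt Q)) = sum_list (map ?w Q)" by (induction Q) simp_all
  also have "\<dots> \<le> real cost" using Q(3) P(2) by (simp add: D.awalk_cost_def)
  finally have "sum_list (map wt Q) \<le> cost" by (simp only: of_nat_le_iff)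
  note uniq = arc_unique[OF c s Q(1,2)[unfolded u_def v_def] this[unfolded cost_def], folded u_def]
  have P_step: "x = cyc c (lay x) \<and> y = cyc c (Suc (lay x) mod L)" if xy: "(x, y) \<in> set P" for x y
  proof -
    obtain k h where kh: "1 \<le> h" "k + h \<le> L - 2" "walk_vertex u Q k = x" "walk_vertex u Q (k + h) = y"
      using sub[OF xy] uniq(1) by auto
    define j where "j = (s + k) mod L"
    have j: "j < L" using L_pos by (simp add: j_def)
    have x: "x = cyc c j" using uniq(2)[of k] kh by (simp add: j_def)
    have y: "y = cyc c ((j + h) mod L)"
      using uniq(2)[of "k + h"] kh by (simp add: j_def mod_simps add.assoc)
    have "h = 1"
    proof (rule ccontr)
      assume "h \<noteq> 1"
      then have na: "nonadj j ((j + h) mod L)" using kh by (intro nonadj_shift[OF j]) auto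
      then have "(x, y) \<in> arcset" using extra[OF na] xy Pc x y by auto
      then have "(j + h) mod L = Suc j mod L"
        using arc_facts(3)[of x y] lay_cyc[OF c] x y j L_pos by simp
      then show False using na by (simp add: nonadj_def)
    qed
    then show ?thesis using x y lay_cyc[OF c j] by simp
  qed
  have P_nth: "lay (walk_vertex u P k) = (s + k) mod L" if "k \<le> length P" for k
    using that
  proof (induction k)
    case 0
    then show ?case using lay_cyc[OF c s] s by (simp add: u_def)
  next
    case (Suc k)
    have "(walk_vertex u P k, walk_vertex u P (Suc k)) \<in> set P"
      using pcas_nth[OF Pc(1), of k] Suc.prems by (metis Suc_le_eq nth_mem)
    from P_step[OF this] have "lay (walk_vertex u P (Suc k)) = Suc (lay (walk_vertex u P k)) mod L"
      using lay_cyc[OF c] L_pos by (metis mod_less_divisor)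
    then show ?case using Suc by (simp add: mod_simps)
  qed
  \<comment> \<open>The end layers fix the length of \<open>P\<close> modulo \<open>L\<close>, and
    \<open>L - 2\<close> is the least possible value.\<close>
  have "L - 2 \<le> length P"
  proof (rule ccontr)
    assume short: "\<not> L - 2 \<le> length P"
    have "(s + (L - 2)) mod L = (s + length P) mod L"
      using P_nth[of "length P"] walk_vertex_length[OF Pc(1)] lay_cyc[OF c, of "(s + (L - 2)) mod L"] L_pos
      by (simp add: v_def)
    then have "(L - s + (s + (L - 2))) mod L = (L - s + (s + length P)) mod L"
      by (metis mod_add_right_eq)
    moreover have "L - s + (s + (L - 2)) = L - 2 + L" "L - s + (s + length P) = length P + L"
      using s by simp_all
    ultimately have "(L - 2 + L) mod L = (length P + L) mod L" by simp
    then have "(L - 2) mod L = length P mod L" by (simp only: mod_add_self2)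
    then show False using L_ge short by simp
  qed
  then have kP: "k < length P" using k by simp
  have e: "(walk_vertex u P k, walk_vertex u P (Suc k)) \<in> set P"
    using pcas_nth[OF Pc(1) kP] kP by (metis nth_mem)
  have "cyc_step c (s + k) = (walk_vertex u P k, walk_vertex u P (Suc k))"
    using P_step[OF e] P_nth[of k] kP by (simp add: cyc_step_def mod_Suc_eq)
  then show ?thesis using e Pc by auto
qed

text \<open>Pigeonhole: the layers of a pair in \<open>F\<close> give its indices, and by
  \<open>cyc_eqI\<close> the pair then determines the cycle, so choosing one pair per cycle is
  injective.\<close>

lemma exists_cycle_without_extra_arcs:
  assumes "finite F" "card F < card params"
  shows "\<exists>c\<in>params. \<forall>i j. nonadj i j \<longrightarrow> (cyc c i, cyc c j) \<notin> F"
proof (rule ccontr)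
  assume "\<not> ?thesis"
  then obtain I J where IJ: "\<And>c. c \<in> params \<Longrightarrow> nonadj (I c) (J c) \<and> (cyc c (I c), cyc c (J c)) \<in> F"
    by metis
  have "inj_on (\<lambda>c. (cyc c (I c), cyc c (J c))) params"
  proof (rule inj_onI)
    fix c c' assume c: "c \<in> params" "c' \<in> params"
      and e: "(cyc c (I c), cyc c (J c)) = (cyc c' (I c'), cyc c' (J c'))"
    have "I c < L" "J c < L" "I c' < L" "J c' < L" using IJ c by (auto simp: nonadj_def)
    then have "I c = I c'" "J c = J c'" using e lay_cyc c by (metis prod.inject)+
    then show "c = c'" using cyc_eqI[OF c, of "I c" "J c"] IJ[OF c(1)] e by simp
  qed
  then have "card params \<le> card F" using IJ assms(1) by (intro card_inj_on_le) auto
  then show False using assms(2) by simp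
qed

lemma dag_cover_bound:
  assumes n: "L * q * q \<le> n"
    and cover: "dag_cover (graph n) f g D" "exact_distance_preserving (graph n) (\<lambda>e. real (wt e)) g D wD"
    and f: "f < real ((l * r)\<^sup>2 * r\<^sup>2)"
  shows "l \<le> g"
proof -
  interpret G: pair_digraph "graph n" by (rule pair_digraph_graph[OF n])
  define F where "F = (\<Union>i<g. parcs (D i)) - arcset"
  have D: "pair_digraph (D d)" "acyclic (parcs (D d))" "pverts (D d) = {..<n}" if "d < g" for d
    using cover(1) that by (auto simp: dag_cover_def)
  have "finite (parcs (D d))" if "d < g" for d
    using D(1)[OF that] by (simp add: pair_digraph_def pair_fin_digraph_def pair_fin_digraph_axioms_def)
  then have finF: "finite F" by (auto simp: F_def)
  have "real (card F) \<le> f" using cover(1) by (simp add: dag_cover_def F_def)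
  then have "real (card F) < real (card params)" using f card_params by simp
  then have "card F < card params" by (simp only: of_nat_less_iff)
  then obtain c where c: "c \<in> params" and free: "\<And>i j. nonadj i j \<Longrightarrow> (cyc c i, cyc c j) \<notin> F"
    using exists_cycle_without_extra_arcs[OF finF] by blast
  have cn: "cyc c j < n" if "j < L" for j
    using cyc_less[OF c that] n by simp
  have "\<exists>d<g. \<forall>k<L - 2. cyc_step c (2 * i + k) \<in> parcs (D d)" if "i < l" for i
  proof -
    define u v where "u = cyc c (2 * i)" and "v = cyc c ((2 * i + (L - 2)) mod L)"
    have i: "2 * i < L" using that by (simp add: L_def)
    have uv: "u < n" "v < n" using cn i L_pos by (auto simp: u_def v_def)
    have "pcas u (map (\<lambda>k. cyc_step c (2 * i + k)) [0..<L - 2]) v"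
      using cyc_step_walk[of c "2 * i" "L - 2"] i by (simp add: u_def v_def)
    then have "G.awalk u (map (\<lambda>k. cyc_step c (2 * i + k)) [0..<L - 2]) v"
      using uv cyc_step_arc[OF c] by (auto simp: G.awalk_def)
    from G.min_cost_le_walk_cost[OF this, of "\<lambda>e. real (wt e)"]
    have "G.\<mu> (\<lambda>e. real (wt e)) u v < \<infinity>" by (rule le_less_trans) simp
    moreover have INF: "G.\<mu> (\<lambda>e. real (wt e)) u v = (INF d\<in>{..<g}. weighted_dist (D d) (wD d) u v)"
      using cover(2) uv by (auto simp: exact_distance_preserving_def)
    \<comment> \<open>For \<open>g = 0\<close> the infimum would be infinite, whereas the arc has
      finite cost; a finite nonempty infimum is attained by some DAG.\<close>
    ultimately have "{..<g} \<noteq> {}" by (auto simp: top_ereal_def)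
    then have "(INF d\<in>{..<g}. weighted_dist (D d) (wD d) u v)
        \<in> (\<lambda>d. weighted_dist (D d) (wD d) u v) ` {..<g}"
      by (intro finite_INF_in) auto
    then obtain d where d: "d < g" "weighted_dist (D d) (wD d) u v = G.\<mu> (\<lambda>e. real (wt e)) u v"
      using INF by auto
    have ge: "weighted_dist (graph n) (\<lambda>e. real (wt e)) x y \<le> weighted_dist (D d) (wD d) x y"
      if "x < n" "y < n" for x y
      using cover(2) d(1) that unfolding exact_distance_preserving_def graph_simps lessThan_iff by blast
    have extra: "(cyc c a, cyc c b) \<in> arcset" if "nonadj a b" "(cyc c a, cyc c b) \<in> parcs (D d)" for a b
      using free[OF that(1)] that(2) d(1) by (auto simp: F_def)
    have "cyc_step c (2 * i + k) \<in> parcs (D d)" if "k < L - 2" for k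
      using covered_arc[OF n c i D[OF d(1)] ge d(2)[unfolded u_def v_def] extra that] by blast
    then show ?thesis using d(1) by blast
  qed
  then obtain \<delta> where \<delta>: "\<And>i. i < l \<Longrightarrow> \<delta> i < g"
    "\<And>i k. i < l \<Longrightarrow> k < L - 2 \<Longrightarrow> cyc_step c (2 * i + k) \<in> parcs (D (\<delta> i))"
    by metis
  have "inj_on \<delta> {..<l}"
  proof (rule inj_onI, rule ccontr)
    fix i i' assume i: "i \<in> {..<l}" "i' \<in> {..<l}" and eq: "\<delta> i = \<delta> i'" and ne: "i \<noteq> i'"
    \<comment> \<open>The arc from layer \<open>2 * m\<close> misses just the edges leaving layers
      \<open>2 * m - 2\<close> and \<open>2 * m - 1\<close> modulo \<open>L\<close>, which are the
      \<open>j\<close> with \<open>(j + 2) div 2 mod l = m\<close>. For \<open>i\<close> and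
      \<open>i'\<close> these pairs are disjoint, so a common DAG contains every edge.\<close>
    have step: "cyc_step c j \<in> parcs (D (\<delta> m))"
      if "j < L" "(j + 2) div 2 mod l \<noteq> m" "m < l" for j m
    proof (cases "2 * m \<le> j")
      case True
      have "j - 2 * m < L - 2"
      proof (rule ccontr)
        assume "\<not> ?thesis"
        then have "m = 0" "(j + 2) div 2 = l" using that(1) True L_ge by (auto simp: L_def)
        then show False using that(2) by simp
      qed
      from \<delta>(2)[OF that(3) this] show ?thesis using True by simp
    next
      case False
      have "j + L - 2 * m < L - 2"
      proof (rule ccontr)
        assume "\<not> ?thesis"
        then have "(j + 2) div 2 = m" using False that(3) L_ge by (auto simp: L_def)
        then show False using that(2,3) by simp
      qed
      from \<delta>(2)[OF that(3) this]
      have "cyc_step c (j + L) \<in> parcs (D (\<delta> m))" using that(3) by (simp add: L_def)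
      then show ?thesis by (simp add: cyc_step_def mod_Suc_eq flip: add_Suc)
    qed
    have all: "cyc_step c j \<in> parcs (D (\<delta> i))" for j
    proof -
      have "j mod L < L" using L_pos by simp
      then have "cyc_step c (j mod L) \<in> parcs (D (\<delta> i))"
        using step[of "j mod L" i] step[of "j mod L" i'] i eq ne by (metis lessThan_iff)
      then show ?thesis by (simp add: cyc_step_def mod_Suc_eq)
    qed
    \<comment> \<open>At \<open>k = L - 1\<close> this is a closed walk in a DAG.\<close>
    have "(cyc c 0, cyc c (Suc k mod L)) \<in> (parcs (D (\<delta> i)))\<^sup>+" for k
    proof (induction k)
      case 0
      then show ?case using all[of 0] L_ge by (auto simp: cyc_step_def)
    next
      case (Suc k)
      then show ?case using all[of "Suc k"] by (auto simp: cyc_step_def intro: trancl_into_trancl)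
    qed
    from this[of "L - 1"] show False
      using D(2)[of "\<delta> i"] \<delta>(1) i L_ge by (auto simp: acyclic_def)
  qed
  then have "card {..<l} \<le> card {..<g}" using \<delta>(1) by (intro card_inj_on_le) auto
  then show ?thesis by simp
qed

end

subsection \<open>The family\<close>

text \<open>The largest \<open>k\<close> whose graph fits into \<open>n\<close> vertices; see
  \<open>layered_cycles_card\<close>.\<close>

definition scale :: "nat \<Rightarrow> nat" where
  "scale n = (GREATEST k. 8 * k ^ 12 \<le> n)"

lemma scale_le: "8 * scale n ^ 12 \<le> n" and scale_greatest: "8 * k ^ 12 \<le> n \<Longrightarrow> k \<le> scale n"
proof -
  have bound: "k \<le> n" if "8 * k ^ 12 \<le> n" for k
  proof (cases "k = 0")
    case False
    then have "k \<le> k ^ 12" by (intro self_le_power) linarith+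
    then show ?thesis using that by linarith
  qed simp
  show "8 * scale n ^ 12 \<le> n"
    unfolding scale_def by (rule GreatestI_nat[of _ 0 n]) (use bound in \<open>simp_all del: power_numeral\<close>)
  show "k \<le> scale n" if "8 * k ^ 12 \<le> n"
    unfolding scale_def by (rule Greatest_le_nat[of _ k n]) (use that bound in blast)+
qed

abbreviation family_arcs :: "nat \<Rightarrow> (nat \<times> nat) set" where
  "family_arcs n \<equiv> layered_cycles.arcset (scale n ^ 2) (scale n ^ 3)"

text \<open>Below scale \<open>2\<close> the assumptions of \<open>layered_cycles\<close> fail; this
  concerns finitely many \<open>n\<close>, which get no arcs.\<close>

definition family :: "nat \<Rightarrow> nat pair_pre_digraph" where
  "family n = \<lparr>pverts = {..<n}, parcs = (if 2 \<le> scale n then family_arcs n else {})\<rparr>"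

definition family_wt :: "nat \<Rightarrow> nat \<times> nat \<Rightarrow> nat" where
  "family_wt n = layered_cycles.wt (scale n ^ 2) (scale n ^ 3)"

lemma layered_cycles_scale: "2 \<le> k \<Longrightarrow> layered_cycles (k ^ 2) (k ^ 3)"
  using self_le_power[of k 2] by unfold_locales auto

lemma layered_cycles_card:
  "layered_cycles.L (k ^ 2) * layered_cycles.q (k ^ 2) (k ^ 3) * layered_cycles.q (k ^ 2) (k ^ 3) = 8 * k ^ 12"
  if "2 \<le> k"
proof -
  interpret layered_cycles "k ^ 2" "k ^ 3" using that by (rule layered_cycles_scale)
  show ?thesis by (simp add: L_def q_def flip: power_add)
qed

lemma pair_digraph_family: "pair_digraph (family n)"
proof (cases "2 \<le> scale n")
  case True
  interpret layered_cycles "scale n ^ 2" "scale n ^ 3" using True by (rule layered_cycles_scale)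
  show ?thesis
    using pair_digraph_graph[of n] layered_cycles_card[OF True] scale_le[of n] True
    by (simp add: family_def graph_def)
next
  case False
  then show ?thesis by (unfold_locales) (auto simp: family_def)
qed

lemma family_wt_bounds:
  assumes "e \<in> parcs (family n)" shows "0 < family_wt n e" "family_wt n e \<le> n"
proof -
  have k: "2 \<le> scale n" using assms by (auto simp: family_def split: if_splits)
  interpret layered_cycles "scale n ^ 2" "scale n ^ 3" using k by (rule layered_cycles_scale)
  have "0 < (scale n ^ 3) ^ 2" using k by simp
  then show "0 < family_wt n e" using wt_ge[of e] unfolding family_wt_def by (rule less_le_trans)
  have "family_wt n e \<le> scale n ^ 2 * (scale n ^ 3) ^ 2"
    using wt_le[of e] assms k by (simp add: family_wt_def family_def)
  also have "\<dots> = scale n ^ 8" by (simp flip: power_add power_mult)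
  also have "\<dots> \<le> scale n ^ 12" using k by (intro power_increasing) auto
  also have "\<dots> \<le> n" using scale_le[of n] by simp
  finally show "family_wt n e \<le> n" .
qed

text \<open>\<open>64 \<le> k\<close> gives \<open>8 \<le> k powr (1 / 2)\<close>, so there are at
  most \<open>k powr (31 / 2)\<close> edges, and \<open>31 / 2 * (33 / 32) < 16\<close>. The right
  side is the number of cycles.\<close>

lemma card_family_powr_less:
  assumes k: "64 \<le> scale n" and \<epsilon>: "0 < \<epsilon>" "\<epsilon> \<le> 1 / 32"
  shows "real (card (parcs (family n))) powr (1 + \<epsilon>) < real (scale n ^ 16)"
proof -
  define k where "k = scale n"
  have k: "64 \<le> real k" "2 \<le> k" using k by (auto simp: k_def)
  interpret layered_cycles "k ^ 2" "k ^ 3" using k by (intro layered_cycles_scale)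
  have "card (parcs (family n)) \<le> 8 * k ^ 12 * k ^ 3"
    using card_arcset(2) k(2) unfolding layered_cycles_card[OF k(2)] family_def k_def[symmetric]
    by simp
  also have "\<dots> = 8 * k ^ 15" by (simp only: mult.assoc flip: power_add) simp
  finally have "card (parcs (family n)) \<le> 8 * k ^ 15" .
  then have "real (card (parcs (family n))) \<le> 8 * real k ^ 15"
    by (metis of_nat_le_iff of_nat_mult of_nat_numeral of_nat_power)
  also have "\<dots> \<le> real k powr (1 / 2) * real k ^ 15"
  proof -
    have "8 = (64 :: real) powr (1 / 2)" by (simp add: powr_half_sqrt real_sqrt_unique)
    also have "\<dots> \<le> real k powr (1 / 2)" using k by (intro powr_mono2) auto
    finally show ?thesis by (intro mult_right_mono) auto
  qed
  also have "\<dots> = real k powr (31 / 2)"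
    using k powr_realpow[of "real k" 15] powr_add[of "real k" "1 / 2" 15] by simp
  finally have "real (card (parcs (family n))) powr (1 + \<epsilon>) \<le> (real k powr (31 / 2)) powr (1 + \<epsilon>)"
    using \<epsilon> by (intro powr_mono2) auto
  also have "\<dots> = real k powr (31 / 2 * (1 + \<epsilon>))" by (rule powr_powr)
  also have "\<dots> < real k powr 16"
    using k \<epsilon> by (intro powr_less_mono) auto
  also have "\<dots> = real (k ^ 16)" using k powr_realpow[of "real k" 16] by simp
  finally show ?thesis by (simp add: k_def)
qed

lemma family_bound:
  assumes k: "64 \<le> scale n" and \<epsilon>: "0 < \<epsilon>" "\<epsilon> \<le> 1 / 32"
    and cover: "dag_cover (family n) (real (card (parcs (family n))) powr (1 + \<epsilon>)) g D"
      "exact_distance_preserving (family n) (\<lambda>e. real (family_wt n e)) g D wD"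
  shows "scale n ^ 2 \<le> g"
proof -
  have k2: "2 \<le> scale n" using k by simp
  interpret layered_cycles "scale n ^ 2" "scale n ^ 3" using k2 by (rule layered_cycles_scale)
  have G: "family n = graph n" using k2 by (simp add: family_def graph_def)
  have "(scale n ^ 2 * scale n ^ 3)\<^sup>2 * (scale n ^ 3)\<^sup>2 = scale n ^ 16"
    by (simp flip: power_add power_mult)
  then show ?thesis
    using dag_cover_bound[of n _ g D wD] layered_cycles_card[OF k2] scale_le[of n] cover
      card_family_powr_less[OF k \<epsilon>]
    unfolding G family_wt_def by simp
qed

text \<open>By maximality \<open>n < 8 * Suc k ^ 12\<close>, and \<open>Suc k \<le> 2 * k\<close>
  turns this into \<open>2 ^ 15 * k ^ 12\<close>, which is below the sixth power of
  \<open>8 * k ^ 2\<close>.\<close>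

lemma scale_lower:
  assumes "1 \<le> scale n" shows "real n powr (1 / 6) \<le> 8 * real (scale n ^ 2)"
proof -
  define k where "k = scale n"
  have k: "1 \<le> k" using assms by (simp add: k_def)
  have "\<not> 8 * Suc k ^ 12 \<le> n" using scale_greatest[of "Suc k" n] by (auto simp: k_def)
  then have "n \<le> 8 * Suc k ^ 12" by simp
  also have "\<dots> \<le> 8 * (2 * k) ^ 12" using k by (intro mult_le_mono2 power_mono) auto
  also have "\<dots> \<le> (8 * k ^ 2) ^ 6" by (simp add: power_mult_distrib flip: power_mult)
  finally have "real n \<le> (8 * real (k ^ 2)) ^ 6"
    by (metis of_nat_le_iff of_nat_mult of_nat_numeral of_nat_power)
  then have "real n powr (1 / 6) \<le> ((8 * real (k ^ 2)) ^ 6) powr (1 / 6)"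
    by (intro powr_mono2) auto
  also have "\<dots> = 8 * real (k ^ 2)"
  proof -
    have "0 < 8 * real (k ^ 2)" using k by simp
    then have "((8 * real (k ^ 2)) ^ 6) powr (1 / 6) = (8 * real (k ^ 2)) powr (real 6 * (1 / 6))"
      by (simp only: powr_powr flip: powr_realpow)
    then show ?thesis using \<open>0 < _\<close> by simp
  qed
  finally show ?thesis by (simp add: k_def)
qed

theorem theorem4:
  shows "\<exists>(G :: nat \<Rightarrow> nat pair_pre_digraph) (w :: nat \<Rightarrow> nat \<times> nat \<Rightarrow> nat).
    (\<forall>n. pair_digraph (G n) \<and> card (pverts (G n)) = n) \<and>
    (\<forall>n. \<forall>e\<in>parcs (G n). 0 < w n e) \<and>
    (\<exists>C k :: nat. \<forall>n. \<forall>e\<in>parcs (G n). w n e \<le> C * n ^ k) \<and>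
    (\<exists>\<epsilon>0 > 0 :: real. \<forall>\<epsilon>. 0 < \<epsilon> \<and> \<epsilon> \<le> \<epsilon>0 \<longrightarrow>
      (\<exists>c > 0 :: real. \<exists>N :: nat. \<forall>n\<ge>N.
        \<forall>(g :: nat) (D :: nat \<Rightarrow> nat pair_pre_digraph) (wD :: nat \<Rightarrow> (nat \<times> nat) weight_fun).
          dag_cover (G n) (real (card (parcs (G n))) powr (1 + \<epsilon>)) g D \<and>
          exact_distance_preserving (G n) (\<lambda>e. real (w n e)) g D wD \<longrightarrow>
            c * real n powr (1 / 6) \<le> real g))"
proof (intro exI[of _ family] exI[of _ family_wt] conjI)
  show "\<forall>n. pair_digraph (family n) \<and> card (pverts (family n)) = n"
    using pair_digraph_family by (simp add: family_def)
  show "\<forall>n. \<forall>e\<in>parcs (family n). 0 < family_wt n e"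
    using family_wt_bounds(1) by blast
  show "\<exists>C k :: nat. \<forall>n. \<forall>e\<in>parcs (family n). family_wt n e \<le> C * n ^ k"
    using family_wt_bounds(2) by (intro exI[of _ 1]) simp
  \<comment> \<open>The factor \<open>1 / 8\<close> comes from \<open>scale_lower\<close>, the bound
    \<open>1 / 32\<close> from \<open>card_family_powr_less\<close>; the threshold on
    \<open>n\<close> makes the scale at least \<open>64\<close>.\<close>
  have main: "1 / 8 * real n powr (1 / 6) \<le> real g"
    if "0 < \<epsilon>" "\<epsilon> \<le> 1 / 32" "8 * 64 ^ 12 \<le> n"
      "dag_cover (family n) (real (card (parcs (family n))) powr (1 + \<epsilon>)) g D"
      "exact_distance_preserving (family n) (\<lambda>e. real (family_wt n e)) g D wD"
    for \<epsilon> n g D wD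
  proof -
    have k: "64 \<le> scale n" using that(3) by (rule scale_greatest)
    have "real (scale n ^ 2) \<le> real g"
      using family_bound[OF k that(1,2,4,5)] by (simp only: of_nat_le_iff)
    then show ?thesis using scale_lower[of n] k by linarith
  qed
  show "\<exists>\<epsilon>0 > 0 :: real. \<forall>\<epsilon>. 0 < \<epsilon> \<and> \<epsilon> \<le> \<epsilon>0 \<longrightarrow>
      (\<exists>c > 0 :: real. \<exists>N :: nat. \<forall>n\<ge>N.
        \<forall>(g :: nat) (D :: nat \<Rightarrow> nat pair_pre_digraph) (wD :: nat \<Rightarrow> (nat \<times> nat) weight_fun).
          dag_cover (family n) (real (card (parcs (family n))) powr (1 + \<epsilon>)) g D \<and>
          exact_distance_preserving (family n) (\<lambda>e. real (family_wt n e)) g D wD \<longrightarrow>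
            c * real n powr (1 / 6) \<le> real g)"
    using main
    by (intro exI[of _ "1 / 32"] conjI allI impI exI[of _ "1 / 8"] exI[of _ "8 * 64 ^ 12"]) auto
qed

end
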